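(* Let $k\ge2$ be an integer. There exist constants $c_1,c_2>0$ depending only on $k$ such that for every $n\ge16$ and every $p\in(0,1]$ the following holds. Suppose we observe a random order-$k$ tensor $T\in\{0,1\}^{n^k}$ with independent Bernoulli entries and $\mathbb{E}T=\theta$, where $\theta\in[0,p]^{n^k}$. Then $$\inf_{\hat\theta}\ \sup_{\theta\in[0,p]^{n^k}}\mathbb{P}\Big(\|\hat\theta-\theta\|\ge(c_1\sqrt{np})\wedge(c_2n^{k/2}p)\Big)\ge\frac13,$$ where the infimum is over all functions $\hat\theta:\mathbb{R}^{n^k}\to\mathbb{R}^{n^k}$, $T\mapsto\hat\theta(T)$, and $\mathbb{P}$ is the law of $T$ with $\mathbb{E}T=\theta$. In particular, if in addition $p\ge\frac{c\log n}{n}$ for a constant $c>0$, then there exists a constant $c_3>0$ depending only on $k$ and $c$ such that $$\inf_{\hat\theta}\ \sup_{\theta\in[0,p]^{n^k}}\mathbb{P}\Big(\|\hat\theta-\theta\|\ge c_3\sqrt{np}\Big)\ge\frac13.$$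
   Context: $\mathbb{R}^{n^k}$ denotes the set of real order-$k$ tensors of dimension $n\times\cdots\times n$, and $[0,p]^{n^k}$ those with all entries in $[0,p]$. $a\wedge b=\min(a,b)$. The spectral norm of $T\in\mathbb{R}^{n^k}$ is $$\|T\|:=\sup_{\|x_1\|_2=\cdots=\|x_k\|_2=1}\Big|\sum_{i_1,\dots,i_k\in[n]}t_{i_1,\dots,i_k}x_{1,i_1}\cdots x_{k,i_k}\Big|,$$ the supremum being over unit vectors in $\mathbb{R}^n$. In the probabilities, $\hat\theta$ stands for $\hat\theta(T)$. *)

theory Defs
  imports "HOL-Probability.Probability"
begin

text \<open>
  The multi-indices \<open>(i\<^sub>1, \<dots>, i\<^sub>k) \<in> [n]\<^sup>k\<close> are rendered, shifted to start at \<open>0\<close>, as the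
  extensional functions from \<open>{..<k}\<close> to \<open>{..<n}\<close>.
\<close>

definition multi_indices :: "nat \<Rightarrow> nat \<Rightarrow> (nat \<Rightarrow> nat) set" where
  "multi_indices k n = {..<k} \<rightarrow>\<^sub>E {..<n}"

type_synonym tensor = "(nat \<Rightarrow> nat) \<Rightarrow> real"

definition tensors_in :: "real set \<Rightarrow> nat \<Rightarrow> nat \<Rightarrow> tensor set" where
  "tensors_in S k n = multi_indices k n \<rightarrow>\<^sub>E S"

abbreviation tensors :: "nat \<Rightarrow> nat \<Rightarrow> tensor set" where
  "tensors \<equiv> tensors_in UNIV"

definition unit_vectors :: "nat \<Rightarrow> (nat \<Rightarrow> real) set" where
  "unit_vectors n = {v \<in> {..<n} \<rightarrow>\<^sub>E UNIV. L2_set v {..<n} = 1}"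

text \<open>
  For \<open>n \<ge> 1\<close> this real-valued supremum ranges over a nonempty bounded set.
  It reads only the entries of \<open>T\<close> at \<open>multi_indices k n\<close>.
\<close>

definition spectral_norm :: "nat \<Rightarrow> nat \<Rightarrow> tensor \<Rightarrow> real" where
  "spectral_norm k n T =
     (SUP x \<in> {..<k} \<rightarrow>\<^sub>E unit_vectors n.
        \<bar>\<Sum>i\<in>multi_indices k n. T i * (\<Prod>j<k. x j (i j))\<bar>)"

text \<open>
  The law of a \<open>{0,1}\<close>-valued tensor with independent Bernoulli entries and mean \<open>\<theta>\<close>
  (meaningful when all entries of \<open>\<theta>\<close> lie in \<open>[0,1]\<close>).
\<close>

definition bernoulli_tensor :: "nat \<Rightarrow> nat \<Rightarrow> tensor \<Rightarrow> tensor pmf" where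
  "bernoulli_tensor k n \<theta> =
     Pi_pmf (multi_indices k n) undefined (\<lambda>i. map_pmf of_bool (bernoulli_pmf (\<theta> i)))"

text \<open>
  The infimum over all (not necessarily measurable) estimators \<open>h\<close> of the worst-case
  probability of an error of at least \<open>r\<close>. For \<open>p \<ge> 0\<close> both index sets are nonempty, and the
  probabilities lie in \<open>[0,1]\<close>, so the real-valued infimum and supremum are the genuine ones.
\<close>

definition minimax_error_prob :: "nat \<Rightarrow> nat \<Rightarrow> real \<Rightarrow> real \<Rightarrow> real" where
  "minimax_error_prob k n p r =
     (INF h \<in> tensors k n \<rightarrow> tensors k n.
        SUP \<theta> \<in> tensors_in {0..p} k n.
          measure_pmf.prob (bernoulli_tensor k n \<theta>)
            {T. spectral_norm k n (\<lambda>i. h T i - \<theta> i) \<ge> r})"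

end

(* Assouad-type argument.  For A \<subseteq> [n] let theta_A have entries p/2 * (1 + s) where the first
   index lies in A and p/2 elsewhere, where s = 1/2 * min 1 (sqrt (n / (p * n^k))).  Two such tensors differ by a rank-one tensor whose spectral
   norm grows like the square root of the Hamming distance of the two sets, so for given data T all
   sets A for which the estimator succeeds lie in one Hamming ball of radius n/16, which contains
   an exponentially small fraction of the 2^n sets.  Relative to the constant tensor p/2 the
   likelihood ratios have second moment at most exp (n/4), which is not enough to compensate. *)
theory Submission
  imports Defs
begin

section \<open>Multilinear forms and separation in spectral norm\<close>

lemma finite_multi_indices [simp]: "finite (multi_indices k n)"
  by (simp add: multi_indices_def finite_PiE)

lemma card_multi_indices: "card (multi_indices k n) = n ^ k"
  by (simp add: multi_indices_def card_PiE)

lemma sum_multi_indices_prod: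
  fixes g :: "nat \<Rightarrow> nat \<Rightarrow> real"
  shows "(\<Sum>i\<in>multi_indices k n. \<Prod>j<k. g j (i j)) = (\<Prod>j<k. \<Sum>a<n. g j a)"
  unfolding multi_indices_def by (subst prod_sum_PiE) auto

lemma unit_vectors_abs_le_1:
  assumes "v \<in> unit_vectors n" "a < n"
  shows "\<bar>v a\<bar> \<le> 1"
proof -
  have "v a ^ 2 \<le> (\<Sum>b<n. v b ^ 2)"
    using assms(2) by (intro member_le_sum) auto
  also have "\<dots> = 1"
    using assms(1) by (simp add: unit_vectors_def L2_set_def)
  finally show ?thesis
    by (simp add: abs_square_le_1)
qed

text \<open>Coordinates of unit vectors have absolute value at most 1, so every value of the form is
  bounded by the sum of the \<open>\<bar>T i\<bar>\<close>. Hence the real-valued supremum is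
  genuine and dominates each test value.\<close>

lemma abs_multilinear_le_spectral_norm:
  assumes "x \<in> {..<k} \<rightarrow>\<^sub>E unit_vectors n"
  shows "\<bar>\<Sum>i\<in>multi_indices k n. T i * (\<Prod>j<k. x j (i j))\<bar> \<le> spectral_norm k n T"
  unfolding spectral_norm_def
proof (rule cSUP_upper[OF assms])
  show "bdd_above ((\<lambda>x. \<bar>\<Sum>i\<in>multi_indices k n. T i * (\<Prod>j<k. x j (i j))\<bar>) `
          ({..<k} \<rightarrow>\<^sub>E unit_vectors n))"
  proof (rule bdd_aboveI2)
    fix x assume x: "x \<in> {..<k} \<rightarrow>\<^sub>E unit_vectors n"
    show "\<bar>\<Sum>i\<in>multi_indices k n. T i * (\<Prod>j<k. x j (i j))\<bar> \<le> (\<Sum>i\<in>multi_indices k n. \<bar>T i\<bar>)"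
    proof (rule order.trans[OF sum_abs], rule sum_mono)
      fix i assume i: "i \<in> multi_indices k n"
      have "\<bar>\<Prod>j<k. x j (i j)\<bar> \<le> 1"
        unfolding abs_prod
      proof (rule prod_le_1)
        fix j assume "j \<in> {..<k}"
        then show "0 \<le> \<bar>x j (i j)\<bar> \<and> \<bar>x j (i j)\<bar> \<le> 1"
          using x i unit_vectors_abs_le_1[of "x j" n "i j"]
          by (auto simp: multi_indices_def PiE_def Pi_def)
      qed
      then show "\<bar>T i * (\<Prod>j<k. x j (i j))\<bar> \<le> \<bar>T i\<bar>"
        by (simp add: abs_mult mult_left_le)
    qed
  qed
qed

text \<open>With e the difference of the indicators of \<open>A\<close> and \<open>B\<close>, the
  tensor U - V is the rank-one tensor c e \<otimes> 1 \<otimes> ... \<otimes> 1. Testing it against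
  its own normalized factors gives exactly the left-hand side, and the triangle inequality splits
  the value between \<open>U\<close> and \<open>V\<close>.\<close>

lemma spectral_norm_separation:
  assumes k: "0 < k" and A: "A \<subseteq> {..<n}" and B: "B \<subseteq> {..<n}" and ne: "A \<noteq> B" and c: "0 \<le> c"
    and diff: "\<And>i. i \<in> multi_indices k n \<Longrightarrow> U i - V i = c * (of_bool (i 0 \<in> A) - of_bool (i 0 \<in> B))"
  shows "c * sqrt (card (sym_diff A B)) * sqrt n ^ (k - 1) \<le> spectral_norm k n U + spectral_norm k n V"
proof -
  define D where "D = sym_diff A B"
  define e :: "nat \<Rightarrow> real" where "e a = of_bool (a \<in> A) - of_bool (a \<in> B)" for a
  have D: "finite D" "D \<noteq> {}" "D \<subseteq> {..<n}"
    using A B ne finite_subset[of _ "{..<n}"] by (auto simp: D_def)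
  have d: "0 < card D" and n: "0 < n"
    using D by (auto simp: card_gt_0_iff)
  have sum_e: "(\<Sum>a<n. (e a)\<^sup>2) = card D"
  proof -
    have "(\<Sum>a<n. (e a)\<^sup>2) = (\<Sum>a<n. of_bool (a \<in> D))"
      by (rule sum.cong) (auto simp: e_def D_def)
    then show ?thesis
      using D(3) by (simp add: sum.If_cases Int_absorb1 of_bool_def)
  qed
  \<comment> \<open>The norms of \<open>e\<close> and of the all-ones vector are
    \<open>sqrt (card D)\<close> and \<open>sqrt n\<close>. The value \<open>undefined\<close>
    outside the index ranges makes \<open>x\<close> and its components extensional.\<close>
  define x where "x j = (if j < k then
      (\<lambda>a\<in>{..<n}. if j = 0 then e a / sqrt (card D) else 1 / sqrt n) else undefined)" for j
  have x: "x \<in> {..<k} \<rightarrow>\<^sub>E unit_vectors n"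
  proof (rule PiE_I)
    fix j assume j: "j \<in> {..<k}"
    have "(\<Sum>a<n. (x j a)\<^sup>2) = 1"
      using j d n sum_e
      by (cases "j = 0") (simp_all add: x_def power_divide flip: sum_divide_distrib)
    then show "x j \<in> unit_vectors n"
      using j by (auto simp: unit_vectors_def L2_set_def x_def)
  qed (auto simp: x_def)
  define F where "F T = (\<Sum>i\<in>multi_indices k n. T i * (\<Prod>j<k. x j (i j)))" for T :: tensor
  \<comment> \<open>The entry of U - V depends on the first index alone, so it is absorbed into
    factor 0 and the sum over multi-indices factorizes.\<close>
  define g :: "nat \<Rightarrow> nat \<Rightarrow> real" where "g j a = (if j = 0 then c * e a else 1) * x j a" for j a
  have split0: "(\<Prod>j<k. f j) = f 0 * (\<Prod>j\<in>{1..<k}. f j)" for f :: "nat \<Rightarrow> real"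
    using k by (simp add: prod.atLeast_Suc_lessThan flip: atLeast0LessThan)
  have "F U - F V = (\<Sum>i\<in>multi_indices k n. (U i - V i) * (\<Prod>j<k. x j (i j)))"
    by (simp add: F_def sum_subtractf left_diff_distrib)
  also have "\<dots> = (\<Sum>i\<in>multi_indices k n. \<Prod>j<k. g j (i j))"
    by (rule sum.cong) (simp_all add: diff split0 g_def e_def)
  also have "\<dots> = (\<Prod>j<k. \<Sum>a<n. g j a)"
    by (rule sum_multi_indices_prod)
  also have "\<dots> = (\<Sum>a<n. g 0 a) * (\<Prod>j\<in>{1..<k}. \<Sum>a<n. g j a)"
    by (rule split0)
  also have "(\<Sum>a<n. g 0 a) = c * (\<Sum>a<n. (e a)\<^sup>2) / sqrt (card D)"
    using k by (simp add: g_def x_def sum_distrib_left sum_divide_distrib power2_eq_square mult.assoc)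
  also have "\<dots> = c * sqrt (card D)"
    unfolding sum_e times_divide_eq_right[symmetric] by (simp add: real_div_sqrt)
  also have "(\<Prod>j\<in>{1..<k}. \<Sum>a<n. g j a) = (\<Prod>j\<in>{1..<k}. sqrt n)"
    by (rule prod.cong) (simp_all add: g_def x_def real_div_sqrt)
  also have "\<dots> = sqrt n ^ (k - 1)"
    by simp
  finally have "c * sqrt (card D) * sqrt n ^ (k - 1) = F U - F V"
    by simp
  also have "\<dots> \<le> spectral_norm k n U + spectral_norm k n V"
    using abs_multilinear_le_spectral_norm[OF x, of U] abs_multilinear_le_spectral_norm[OF x, of V]
    unfolding F_def by linarith
  finally show ?thesis
    by (simp add: D_def)
qed

section \<open>Volume of Hamming balls\<close>

text \<open>A Chernoff-type weighting: every member of \<open>G\<close> has weight at least 1, while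
  the weights of all subsets of \<open>{..<n}\<close> sum to (11/10)^n (5/4)^n = (11/8)^n.\<close>

lemma hamming_ball_card_le:
  assumes A: "A \<subseteq> {..<n}" and G: "G \<subseteq> Pow {..<n}"
    and close: "\<And>B. B \<in> G \<Longrightarrow> 16 * card (sym_diff A B) \<le> n"
  shows "real (card G) \<le> (11 / 8) ^ n"
proof -
  have weight: "1 \<le> (11 / 10) ^ n * (1 / 4 :: real) ^ card (sym_diff A B)" if "B \<in> G" for B
  proof -
    \<comment> \<open>The base 11/10 is chosen so that its 16th power, about 4.59, exceeds
      4.\<close>
    have "4 ^ card (sym_diff A B) \<le> ((11 / 10 :: real) ^ 16) ^ card (sym_diff A B)"
      by (intro power_mono) (auto simp: eval_nat_numeral)
    also have "\<dots> \<le> (11 / 10) ^ n"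
      using close[OF that] by (simp flip: power_mult)
    finally show ?thesis
      by (simp add: field_simps power_divide)
  qed
  have "real (card G) \<le> (\<Sum>B\<in>G. (11 / 10) ^ n * (1 / 4 :: real) ^ card (sym_diff A B))"
    using sum_mono[of G "\<lambda>_. 1", OF weight] by simp
  also have "\<dots> \<le> (\<Sum>B\<in>Pow {..<n}. (11 / 10) ^ n * (1 / 4 :: real) ^ card (sym_diff A B))"
    by (rule sum_mono2) (use G in auto)
  \<comment> \<open>Symmetric difference with \<open>A\<close> is an involution on the subsets, so
    the ball may be centred at the empty set.\<close>
  also have "\<dots> = (\<Sum>C\<in>Pow {..<n}. (11 / 10) ^ n * (1 / 4 :: real) ^ card C)"
    by (rule sum.reindex_bij_witness[of _ "\<lambda>C. sym_diff A C" "\<lambda>B. sym_diff A B"])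
      (use A in \<open>auto 0 3 intro: arg_cong[where f = card]\<close>)
  also have "\<dots> = (11 / 10) ^ n * (\<Prod>a<n. 1 / 4 + (1 :: real))"
    by (subst prod_add) (simp_all add: sum_distrib_left)
  also have "\<dots> = (11 / 8) ^ n"
    by (simp flip: power_mult_distrib)
  finally show ?thesis .
qed

section \<open>Averaging over hypotheses with a change of measure\<close>

text \<open>If all success probabilities exceeded \<epsilon>, their sum would exceed \<epsilon> |H|.
  Comparing with \<open>Q\<close> bounds that sum: the likelihood ratios have second moment at most
  \<open>M\<close>, and each outcome lies in at most \<open>K\<close> success events.\<close>

lemma exists_small_success_prob:
  fixes P :: "'a \<Rightarrow> 'b pmf" and Q :: "'b pmf" and \<epsilon> K M :: real
  assumes H: "finite H" "H \<noteq> {}" and S: "finite S"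
    and supp: "\<And>a. a \<in> H \<Longrightarrow> set_pmf (P a) \<subseteq> S"
    and pos: "\<And>T. T \<in> S \<Longrightarrow> 0 < pmf Q T"
    and chi: "\<And>a. a \<in> H \<Longrightarrow> (\<Sum>T\<in>S. (pmf (P a) T)\<^sup>2 / pmf Q T) \<le> M"
    and K: "\<And>T. T \<in> S \<Longrightarrow> real (card {a\<in>H. T \<in> G a}) \<le> K"
    and M: "0 < M" and eps: "0 < \<epsilon>" and small: "M * K \<le> \<epsilon>\<^sup>2 * card H"
  shows "\<exists>a\<in>H. measure_pmf.prob (P a) (G a) \<le> \<epsilon>"
proof (rule ccontr)
  \<comment> \<open>With this weight the second-moment term is exactly \<epsilon> |H| / 2, and by
    \<open>small\<close> the covering term is at most the same amount.\<close>
  define t where "t = \<epsilon> / M"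
  have t: "0 < t"
    using M eps by (simp add: t_def)
  \<comment> \<open>The bound by \<open>K\<close> is available only at points of \<open>S\<close>;
    an empty \<open>S\<close> is excluded since it would contain the support of some
    \<open>P a\<close>.\<close>
  have K0: "0 \<le> K"
  proof (cases "S = {}")
    case True
    then show ?thesis
      using supp H set_pmf_not_empty by fast
  next
    case False
    then show ?thesis
      using K order.trans[OF of_nat_0_le_iff] by blast
  qed
  assume "\<not> ?thesis"
  then have "\<epsilon> * card H < (\<Sum>a\<in>H. measure_pmf.prob (P a) (G a))"
    using sum_strict_mono[OF H, of "\<lambda>_. \<epsilon>" "\<lambda>a. measure_pmf.prob (P a) (G a)"]
    by (simp add: not_le mult.commute)
  also have "\<dots> = (\<Sum>a\<in>H. \<Sum>T\<in>S. if T \<in> G a then pmf (P a) T else 0)"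
  proof (rule sum.cong[OF refl])
    fix a assume "a \<in> H"
    then have "measure_pmf.prob (P a) (G a) = measure_pmf.prob (P a) (S \<inter> G a)"
      using supp by (intro measure_prob_cong_0) (auto simp: pmf_eq_0_set_pmf)
    also have "\<dots> = (\<Sum>T\<in>S \<inter> G a. pmf (P a) T)"
      using S by (simp add: measure_measure_pmf_finite)
    finally show "measure_pmf.prob (P a) (G a) = (\<Sum>T\<in>S. if T \<in> G a then pmf (P a) T else 0)"
      using S by (simp add: sum.inter_restrict)
  qed
  also have "\<dots> \<le> (\<Sum>a\<in>H. \<Sum>T\<in>S. t / 2 * ((pmf (P a) T)\<^sup>2 / pmf Q T)
      + 1 / (2 * t) * (if T \<in> G a then pmf Q T else 0))"
  proof (intro sum_mono)
    fix a T assume T: "T \<in> S"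
    define x q where "x = pmf (P a) T" and "q = pmf Q T"
    have q: "0 < q"
      using pos[OF T] by (simp add: q_def)
    \<comment> \<open>AM-GM, in place of the Cauchy-Schwarz inequality for the sum\<close>
    have "2 * x * (t * q) \<le> (t * x)\<^sup>2 + q\<^sup>2"
      using sum_squares_bound[of "t * x" q] by (simp add: algebra_simps)
    then have "x \<le> t / 2 * (x\<^sup>2 / q) + 1 / (2 * t) * q"
      using t q by (simp add: field_simps power2_eq_square)
    then show "(if T \<in> G a then pmf (P a) T else 0) \<le> t / 2 * ((pmf (P a) T)\<^sup>2 / pmf Q T)
      + 1 / (2 * t) * (if T \<in> G a then pmf Q T else 0)"
      using t by (simp add: x_def q_def)
  qed
  also have "\<dots> = t / 2 * (\<Sum>a\<in>H. \<Sum>T\<in>S. (pmf (P a) T)\<^sup>2 / pmf Q T)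
      + 1 / (2 * t) * (\<Sum>T\<in>S. \<Sum>a\<in>H. if T \<in> G a then pmf Q T else 0)"
    by (subst (2) sum.swap) (simp add: sum.distrib sum_distrib_left)
  also have "\<dots> \<le> t / 2 * (card H * M) + 1 / (2 * t) * K"
  proof (intro add_mono mult_left_mono)
    show "(\<Sum>a\<in>H. \<Sum>T\<in>S. (pmf (P a) T)\<^sup>2 / pmf Q T) \<le> card H * M"
      using sum_bounded_above[of H _ M, OF chi] by simp
    have "(\<Sum>a\<in>H. if T \<in> G a then pmf Q T else 0) = card {a\<in>H. T \<in> G a} * pmf Q T" for T
      using H(1) by (simp add: sum.If_cases Collect_conj_eq)
    then have "(\<Sum>T\<in>S. \<Sum>a\<in>H. if T \<in> G a then pmf Q T else 0) \<le> (\<Sum>T\<in>S. K * pmf Q T)"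
      using K by (auto intro!: sum_mono mult_right_mono)
    also have "\<dots> = K * measure_pmf.prob Q S"
      using S by (simp add: measure_measure_pmf_finite sum_distrib_left)
    also have "\<dots> \<le> K"
      using K0 by (simp add: mult_left_le)
    finally show "(\<Sum>T\<in>S. \<Sum>a\<in>H. if T \<in> G a then pmf Q T else 0) \<le> K" .
  qed (use t in auto)
  also have "\<dots> = \<epsilon> / 2 * card H + M * K / (2 * \<epsilon>)"
    using M eps by (simp add: t_def field_simps)
  also have "\<dots> \<le> \<epsilon> / 2 * card H + \<epsilon>\<^sup>2 * card H / (2 * \<epsilon>)"
    using small eps by (intro add_left_mono divide_right_mono) auto
  also have "\<dots> = \<epsilon> * card H"
    using eps by (simp add: power2_eq_square)
  finally show False
    by simp
qed

section \<open>Likelihood ratios of Bernoulli tensors\<close>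

lemma finite_tensors_in: "finite S \<Longrightarrow> finite (tensors_in S k n)"
  by (simp add: tensors_in_def finite_PiE)

lemma pmf_bernoulli_tensor:
  assumes "T \<in> tensors_in {0, 1} k n" and "\<theta> \<in> tensors_in {0..1} k n"
  shows "pmf (bernoulli_tensor k n \<theta>) T =
    (\<Prod>i\<in>multi_indices k n. if T i = 1 then \<theta> i else 1 - \<theta> i)"
proof -
  have "pmf (bernoulli_tensor k n \<theta>) T =
      (\<Prod>i\<in>multi_indices k n. pmf (map_pmf of_bool (bernoulli_pmf (\<theta> i))) (T i))"
    using assms(1) unfolding bernoulli_tensor_def
    by (intro pmf_Pi') (auto simp: tensors_in_def PiE_def extensional_def)
  also have "\<dots> = (\<Prod>i\<in>multi_indices k n. if T i = 1 then \<theta> i else 1 - \<theta> i)"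
  proof (rule prod.cong[OF refl])
    fix i assume i: "i \<in> multi_indices k n"
    have T: "T i = of_bool (T i = 1)"
      using assms(1) i by (auto simp: tensors_in_def PiE_def Pi_def)
    have "pmf (map_pmf of_bool (bernoulli_pmf (\<theta> i))) (of_bool b :: real) =
        pmf (bernoulli_pmf (\<theta> i)) b" for b
      by (rule pmf_map_inj') (auto simp: inj_def)
    then show "pmf (map_pmf of_bool (bernoulli_pmf (\<theta> i))) (T i) = (if T i = 1 then \<theta> i else 1 - \<theta> i)"
      using assms(2) i by (subst T) (auto simp: tensors_in_def PiE_def Pi_def)
  qed
  finally show ?thesis .
qed

lemma set_pmf_bernoulli_tensor: "set_pmf (bernoulli_tensor k n \<theta>) \<subseteq> tensors_in {0, 1} k n"
proof
  fix T assume "T \<in> set_pmf (bernoulli_tensor k n \<theta>)"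
  then have "T \<in> PiE_dflt (multi_indices k n) undefined
      (set_pmf \<circ> (\<lambda>i. map_pmf of_bool (bernoulli_pmf (\<theta> i))))"
    using set_Pi_pmf_subset' unfolding bernoulli_tensor_def
    by (metis (no_types, lifting) finite_multi_indices subsetD)
  then show "T \<in> tensors_in {0, 1} k n"
    by (force simp: PiE_dflt_def tensors_in_def PiE_def extensional_def)
qed

text \<open>Independence turns the sum over 0-1 tensors into a product over entries; each factor is
  1 plus the chi-square divergence of two Bernoulli laws.\<close>

lemma bernoulli_tensor_second_moment:
  assumes \<theta>: "\<theta> \<in> tensors_in {0..1} k n" and q: "q \<in> tensors_in {0<..<1} k n"
  shows "(\<Sum>T\<in>tensors_in {0, 1} k n.
      (pmf (bernoulli_tensor k n \<theta>) T)\<^sup>2 / pmf (bernoulli_tensor k n q) T) =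
    (\<Prod>i\<in>multi_indices k n. 1 + (\<theta> i - q i)\<^sup>2 / (q i * (1 - q i)))"
proof -
  let ?f = "\<lambda>i t :: real. (if t = 1 then \<theta> i else 1 - \<theta> i)\<^sup>2 / (if t = 1 then q i else 1 - q i)"
  have q01: "q \<in> tensors_in {0..1} k n"
    using q by (auto simp: tensors_in_def PiE_def Pi_def less_imp_le)
  have "(\<Sum>T\<in>tensors_in {0, 1} k n.
      (pmf (bernoulli_tensor k n \<theta>) T)\<^sup>2 / pmf (bernoulli_tensor k n q) T) =
    (\<Sum>T\<in>tensors_in {0, 1} k n. \<Prod>i\<in>multi_indices k n. ?f i (T i))"
    by (rule sum.cong) (simp_all add: pmf_bernoulli_tensor \<theta> q01 prod_dividef flip: prod_power_distrib)
  also have "\<dots> = (\<Prod>i\<in>multi_indices k n. \<Sum>t\<in>{0, 1}. ?f i t)"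
    unfolding tensors_in_def by (rule prod_sum_PiE[symmetric]) auto
  also have "\<dots> = (\<Prod>i\<in>multi_indices k n. 1 + (\<theta> i - q i)\<^sup>2 / (q i * (1 - q i)))"
  proof (rule prod.cong[OF refl])
    fix i assume "i \<in> multi_indices k n"
    then have "0 < q i" "q i < 1"
      using q by (auto simp: tensors_in_def PiE_def Pi_def)
    then show "(\<Sum>t\<in>{0, 1}. ?f i t) = 1 + (\<theta> i - q i)\<^sup>2 / (q i * (1 - q i))"
      by (simp add: field_simps power2_eq_square)
  qed
  finally show ?thesis .
qed

section \<open>The family of hypotheses\<close>

text \<open>The base level is \<open>q\<close>, and \<open>s\<close> is the relative increase on the
  slices selected by \<open>A\<close>; the empty set gives the constant reference tensor.\<close>

definition row_tensor :: "nat \<Rightarrow> nat \<Rightarrow> real \<Rightarrow> real \<Rightarrow> nat set \<Rightarrow> tensor" where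
  "row_tensor k n q s A = (\<lambda>i\<in>multi_indices k n. q * (1 + s * of_bool (i 0 \<in> A)))"

lemma row_tensor_in_tensors:
  assumes "0 \<le> q" "0 \<le> s" "s \<le> 1" "2 * q \<le> p"
  shows "row_tensor k n q s A \<in> tensors_in {0..p} k n"
proof -
  have "q * s \<le> q"
    using assms by (simp add: mult_left_le)
  then show ?thesis
    using assms by (auto simp: row_tensor_def tensors_in_def algebra_simps)
qed

text \<open>Since 1 - q \<ge> 1/2, each of the n^k entries contributes a factor at most 1 + 2 q s^2
  \<le> exp (2 q s^2). By \<open>small\<close> the exponents add up to at most n/4, and exp (1/4)
  \<le> 1 + 1/4 + 1/16 = 21/16.\<close>

lemma row_tensor_second_moment_le:
  assumes q: "0 < q" "2 * q \<le> 1" and s: "0 \<le> s" "s \<le> 1"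
    and small: "8 * real n ^ k * q * s\<^sup>2 \<le> n"
  shows "(\<Sum>T\<in>tensors_in {0, 1} k n. (pmf (bernoulli_tensor k n (row_tensor k n q s A)) T)\<^sup>2
      / pmf (bernoulli_tensor k n (row_tensor k n q s {})) T) \<le> (21 / 16) ^ n"
proof -
  have "row_tensor k n q s {} \<in> tensors_in {0<..<1} k n"
    using q by (auto simp: row_tensor_def tensors_in_def)
  moreover have "row_tensor k n q s A \<in> tensors_in {0..1} k n"
    using q s by (intro row_tensor_in_tensors) auto
  ultimately have "(\<Sum>T\<in>tensors_in {0, 1} k n. (pmf (bernoulli_tensor k n (row_tensor k n q s A)) T)\<^sup>2
      / pmf (bernoulli_tensor k n (row_tensor k n q s {})) T) =
      (\<Prod>i\<in>multi_indices k n. 1 + (q * s * of_bool (i 0 \<in> A))\<^sup>2 / (q * (1 - q)))"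
    by (subst bernoulli_tensor_second_moment)
      (auto intro!: prod.cong simp: row_tensor_def algebra_simps)
  also have "\<dots> \<le> (\<Prod>i\<in>multi_indices k n. exp (2 * q * s\<^sup>2))"
  proof (intro prod_mono conjI)
    fix i
    have "(q * s * of_bool (i 0 \<in> A))\<^sup>2 / (q * (1 - q)) \<le> (q * s)\<^sup>2 / (q * (1 - q))"
      using q by (intro divide_right_mono) auto
    also have "\<dots> \<le> (q * s)\<^sup>2 / (q * (1 / 2))"
      using q by (intro divide_left_mono mult_left_mono) auto
    also have "\<dots> = 2 * q * s\<^sup>2"
      using q by (simp add: power2_eq_square)
    finally show "1 + (q * s * of_bool (i 0 \<in> A))\<^sup>2 / (q * (1 - q)) \<le> exp (2 * q * s\<^sup>2)"
      using exp_ge_add_one_self[of "2 * q * s\<^sup>2"] by linarith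
  qed (use q in auto)
  also have "\<dots> = exp (real n ^ k * (2 * q * s\<^sup>2))"
    by (simp add: card_multi_indices exp_of_nat_mult flip: of_nat_power)
  also have "\<dots> \<le> exp (real n * (1 / 4))"
    using small by simp
  also have "\<dots> = exp (1 / 4) ^ n"
    by (rule exp_of_nat_mult)
  also have "\<dots> \<le> (21 / 16) ^ n"
    using exp_bound[of "1 / 4"] by (intro power_mono) (auto simp: power2_eq_square)
  finally show ?thesis .
qed

section \<open>The lower bound with explicit constants\<close>

text \<open>For each estimator some hypothesis has success probability at most 2/3. The factor 1/32
  is small enough that sets for which the estimator succeeds on the same data differ in at most n/16
  elements.\<close>

lemma minimax_error_prob_ge:
  assumes k: "0 < k" and n: "16 \<le> n" and p: "0 < p" "p \<le> 1"
  shows "1 / 3 \<le> minimax_error_prob k n p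
    (min (1 / 32 * sqrt (real n * p)) (1 / 32 * real n powr (real k / 2) * p))"
proof -
  define N where "N = sqrt n ^ k"
  define m where "m = min (sqrt (n * p)) (N * p)"
  \<comment> \<open>Here \<open>N\<close> is n^(k/2) and \<open>m\<close> is 32 times the target
    rate. The two branches of the minimum serve two purposes: \<open>m \<le> N * p\<close> keeps s
    \<le> 1, and \<open>m\<^sup>2 \<le> n * p\<close> keeps the second moments within budget, as 8
    n^k q s^2 = m^2 / p.\<close>
  define s where "s = m / (2 * p * N)"
  define q where "q = p / 2"
  define r where "r = m / 32"
  let ?\<theta> = "row_tensor k n q s"
  let ?S = "tensors_in {0, 1} k n"
  have N: "0 < N"
    using n by (simp add: N_def)
  have "real n powr (real k / 2) = N"
    using n powr_powr[of n "1 / 2" k] by (simp add: N_def powr_half_sqrt powr_realpow)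
  then have r: "min (1 / 32 * sqrt (real n * p)) (1 / 32 * real n powr (real k / 2) * p) = r"
    by (auto simp: r_def m_def min_def)
  have m: "0 < m" "m \<le> N * p" "m\<^sup>2 \<le> n * p"
  proof -
    show "0 < m" "m \<le> N * p"
      using n p N by (auto simp: m_def)
    then have "m\<^sup>2 \<le> (sqrt (n * p))\<^sup>2"
      by (intro power_mono) (auto simp: m_def)
    then show "m\<^sup>2 \<le> n * p"
      using p by simp
  qed
  have s: "0 < s" "s \<le> 1"
    using m p N by (auto simp: s_def field_simps)
  have q: "0 < q" "2 * q \<le> 1" "2 * q = p"
    using p by (auto simp: q_def)
  have N2: "N\<^sup>2 = real n ^ k"
    by (simp add: N_def power2_eq_square flip: power_mult_distrib)
  have "8 * real n ^ k * q * s\<^sup>2 = m\<^sup>2 / p"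
    using p N unfolding N2[symmetric] by (simp add: q_def s_def field_simps power2_eq_square)
  also have "\<dots> \<le> n"
    using m p by (simp add: field_simps)
  finally have small: "8 * real n ^ k * q * s\<^sup>2 \<le> n" .
  have in_tensors: "?\<theta> A \<in> tensors_in {0..p} k n" for A
    using q s by (intro row_tensor_in_tensors) auto

  have "1 / 3 \<le> (SUP \<theta> \<in> tensors_in {0..p} k n. measure_pmf.prob (bernoulli_tensor k n \<theta>)
      {T. spectral_norm k n (\<lambda>i. h T i - \<theta> i) \<ge> r})" for h
  proof -
    define G where "G A = {T. spectral_norm k n (\<lambda>i. h T i - ?\<theta> A i) < r}" for A
    have dist: "16 * card (sym_diff A B) \<le> n"
      if AB: "A \<subseteq> {..<n}" "B \<subseteq> {..<n}" "T \<in> G A" "T \<in> G B" for A B T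
    proof (cases "A = B")
      case False
      \<comment> \<open>The estimate cancels in the difference of the two errors, leaving the
        hypothesis for \<open>B\<close> minus that for \<open>A\<close>; hence the swapped
        order.\<close>
      have "q * s * sqrt (card (sym_diff B A)) * sqrt n ^ (k - 1) \<le>
          spectral_norm k n (\<lambda>i. h T i - ?\<theta> A i) + spectral_norm k n (\<lambda>i. h T i - ?\<theta> B i)"
        using False AB q s
        by (intro spectral_norm_separation[OF k]) (auto simp: row_tensor_def algebra_simps)
      also have "\<dots> < 2 * r"
        using AB by (simp add: G_def)
      \<comment> \<open>The extra factor \<open>sqrt n\<close> completes the power to
        \<open>N\<close>. As q s N = m/4 and 2 r = m/16, what remains is 4 sqrt d < sqrt n for the
        Hamming distance d.\<close>
      finally have "q * s * sqrt (card (sym_diff A B)) * sqrt n ^ (k - 1) * sqrt n < 2 * r * sqrt n"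
        using n by (simp add: Un_commute)
      moreover have "sqrt n ^ (k - 1) * sqrt n = N"
        unfolding N_def using k by (simp add: power_eq_if)
      ultimately have "q * s * sqrt (card (sym_diff A B)) * N < 2 * r * sqrt n"
        by (simp add: mult.assoc)
      then have "m * (4 * sqrt (card (sym_diff A B))) < m * sqrt n"
        using p N by (simp add: q_def s_def r_def)
      then have "sqrt (16 * card (sym_diff A B)) < sqrt n"
        using m by (simp add: real_sqrt_mult)
      then show ?thesis
        by simp
    qed simp
    have "\<exists>A\<in>Pow {..<n}. measure_pmf.prob (bernoulli_tensor k n (?\<theta> A)) (G A) \<le> 2 / 3"
    proof (rule exists_small_success_prob[where S = ?S and G = G
          and P = "\<lambda>A. bernoulli_tensor k n (?\<theta> A)" and Q = "bernoulli_tensor k n (?\<theta> {})"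
          and M = "(21 / 16) ^ n" and K = "(11 / 8) ^ n"])
      \<comment> \<open>The base level p/2 lies strictly between 0 and 1 even for p = 1, so the
        reference law charges every 0-1 tensor.\<close>
      show "0 < pmf (bernoulli_tensor k n (?\<theta> {})) T" if T: "T \<in> ?S" for T
      proof -
        have \<theta>: "?\<theta> {} \<in> tensors_in {0..1} k n"
          using q s by (intro row_tensor_in_tensors) auto
        show ?thesis
          unfolding pmf_bernoulli_tensor[OF T \<theta>]
          using q by (intro prod_pos) (simp add: row_tensor_def)
      qed
      show "(\<Sum>T\<in>?S. (pmf (bernoulli_tensor k n (?\<theta> A)) T)\<^sup>2 / pmf (bernoulli_tensor k n (?\<theta> {})) T)
          \<le> (21 / 16) ^ n" for A
        using s(1) by (intro row_tensor_second_moment_le[OF q(1,2) _ s(2) small]) simp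
      show "real (card {A \<in> Pow {..<n}. T \<in> G A}) \<le> (11 / 8) ^ n" for T
      proof (cases "{A \<in> Pow {..<n}. T \<in> G A} = {}")
        case False
        \<comment> \<open>Any one set for which the estimator succeeds serves as the centre of the
          ball.\<close>
        then obtain A where "A \<subseteq> {..<n}" "T \<in> G A"
          by blast
        then show ?thesis
          using dist by (intro hamming_ball_card_le[of A]) auto
      next
        case True
        show ?thesis
          unfolding True by simp
      qed
      \<comment> \<open>The product of 21/16 and 11/8 is 2 * 231/256, just below 2; n \<ge> 16
        brings the ratio to the number 2^n of hypotheses below (2/3)^2 = 4/9.\<close>
      have "(231 / 256 :: real) ^ n \<le> (231 / 256) ^ 16"
        using n by (intro power_decreasing) auto
      also have "\<dots> \<le> 4 / 9"
        by (simp add: power_divide)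
      finally have "(231 / 256 :: real) ^ n * 2 ^ n \<le> 4 / 9 * 2 ^ n"
        by (rule mult_right_mono) simp
      also have "(231 / 256 :: real) ^ n * 2 ^ n = (231 / 256 * 2) ^ n"
        by (rule power_mult_distrib[symmetric])
      also have "\<dots> = (21 / 16 * (11 / 8)) ^ n"
        by (rule arg_cong[where f = "\<lambda>x. x ^ n"]) simp
      also have "\<dots> = (21 / 16) ^ n * (11 / 8) ^ n"
        by (rule power_mult_distrib)
      also have "4 / 9 * 2 ^ n = (2 / 3 :: real)\<^sup>2 * card (Pow {..<n})"
        by (simp add: card_Pow power2_eq_square)
      finally show "(21 / 16) ^ n * (11 / 8) ^ n \<le> (2 / 3 :: real)\<^sup>2 * card (Pow {..<n})" .
    qed (simp_all add: set_pmf_bernoulli_tensor finite_tensors_in Pow_not_empty)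
    then obtain A where A: "measure_pmf.prob (bernoulli_tensor k n (?\<theta> A)) (G A) \<le> 2 / 3"
      by blast
    have "{T. spectral_norm k n (\<lambda>i. h T i - ?\<theta> A i) \<ge> r} = - G A"
      by (auto simp: G_def)
    then have "1 / 3 \<le> measure_pmf.prob (bernoulli_tensor k n (?\<theta> A))
        {T. spectral_norm k n (\<lambda>i. h T i - ?\<theta> A i) \<ge> r}"
      using A measure_pmf.prob_compl[of "G A" "bernoulli_tensor k n (?\<theta> A)"]
      by (simp add: Compl_eq_Diff_UNIV)
    also have "\<dots> \<le> (SUP \<theta> \<in> tensors_in {0..p} k n. measure_pmf.prob (bernoulli_tensor k n \<theta>)
        {T. spectral_norm k n (\<lambda>i. h T i - \<theta> i) \<ge> r})"
      by (rule cSUP_upper[OF in_tensors]) (auto intro!: bdd_aboveI2[where M = 1])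
    finally show ?thesis .
  qed
  moreover have "tensors k n \<rightarrow> tensors k n \<noteq> {}"
    by (auto simp: tensors_in_def Pi_eq_empty PiE_eq_empty_iff)
  ultimately show ?thesis
    unfolding minimax_error_prob_def r by (intro cINF_greatest)
qed

section \<open>Passing to the single rate and conclusion\<close>

text \<open>Lowering the threshold enlarges every error event. This lets the minimum of two rates be
  replaced by a smaller single rate.\<close>

lemma minimax_error_prob_antimono:
  assumes "0 \<le> p" "r \<le> r'"
  shows "minimax_error_prob k n p r' \<le> minimax_error_prob k n p r"
  unfolding minimax_error_prob_def
proof (rule cINF_mono)
  have nonempty: "tensors_in {0..p} k n \<noteq> {}"
    using assms(1) by (auto simp: tensors_in_def PiE_eq_empty_iff)
  let ?P = "\<lambda>h r \<theta>. measure_pmf.prob (bernoulli_tensor k n \<theta>)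
      {T. spectral_norm k n (\<lambda>i. h T i - \<theta> i) \<ge> r}"
  have bdd: "bdd_above (?P h r ` tensors_in {0..p} k n)" for h r
    by (auto intro!: bdd_aboveI2[where M = 1])
  show "tensors k n \<rightarrow> tensors k n \<noteq> {}"
    by (auto simp: tensors_in_def Pi_eq_empty PiE_eq_empty_iff)
  obtain \<theta> where \<theta>: "\<theta> \<in> tensors_in {0..p} k n"
    using nonempty by blast
  show "bdd_below ((\<lambda>h. SUP \<theta> \<in> tensors_in {0..p} k n. ?P h r' \<theta>) ` (tensors k n \<rightarrow> tensors k n))"
    by (rule bdd_belowI2[where m = 0]) (rule cSUP_upper2[OF bdd \<theta>], simp)
  fix h assume "h \<in> tensors k n \<rightarrow> tensors k n"
  moreover have "(SUP \<theta> \<in> tensors_in {0..p} k n. ?P h r' \<theta>) \<le> (SUP \<theta> \<in> tensors_in {0..p} k n. ?P h r \<theta>)"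
    using assms(2) by (intro cSUP_mono[OF nonempty bdd])
      (auto intro!: bexI measure_pmf.finite_measure_mono)
  ultimately show "\<exists>h'\<in>tensors k n \<rightarrow> tensors k n.
      (SUP \<theta> \<in> tensors_in {0..p} k n. ?P h' r' \<theta>) \<le> (SUP \<theta> \<in> tensors_in {0..p} k n. ?P h r \<theta>)"
    by blast
qed

theorem theorem2p7:
  fixes k :: nat
  assumes "k \<ge> 2"
  shows "(\<exists>c1>0. \<exists>c2>0. \<forall>n\<ge>16. \<forall>p::real. 0 < p \<and> p \<le> 1 \<longrightarrow>
            minimax_error_prob k n p
              (min (c1 * sqrt (real n * p)) (c2 * real n powr (real k / 2) * p)) \<ge> 1 / 3) \<and>
         (\<forall>c>0. \<exists>c3>0. \<forall>n\<ge>16. \<forall>p::real.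
            0 < p \<and> p \<le> 1 \<and> p \<ge> c * ln (real n) / real n \<longrightarrow>
            minimax_error_prob k n p (c3 * sqrt (real n * p)) \<ge> 1 / 3)"
proof (intro conjI allI impI)
  show "\<exists>c1>0. \<exists>c2>0. \<forall>n\<ge>16. \<forall>p::real. 0 < p \<and> p \<le> 1 \<longrightarrow>
            minimax_error_prob k n p
              (min (c1 * sqrt (real n * p)) (c2 * real n powr (real k / 2) * p)) \<ge> 1 / 3"
    using assms minimax_error_prob_ge[of k]
    by (intro exI[of _ "1 / 32 :: real"] conjI allI impI) simp_all
next
  fix c :: real assume c: "0 < c"
  \<comment> \<open>The entry 1 puts the new rate below the first branch of the minimum. The other
    entry handles the second branch, since n p \<ge> c ln n \<ge> c ln 16.\<close>
  define c3 where "c3 = min 1 (sqrt (c * ln 16)) / 32"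
  show "\<exists>c3>0. \<forall>n\<ge>16. \<forall>p::real. 0 < p \<and> p \<le> 1 \<and> p \<ge> c * ln (real n) / real n \<longrightarrow>
            minimax_error_prob k n p (c3 * sqrt (real n * p)) \<ge> 1 / 3"
  proof (intro exI[of _ c3] conjI allI impI)
    show "0 < c3"
      using c by (simp add: c3_def)
  next
    fix n :: nat and p :: real
    assume n: "16 \<le> n" and p: "0 < p \<and> p \<le> 1 \<and> c * ln (real n) / real n \<le> p"
    have "c * ln 16 \<le> c * ln n"
      using c n by simp
    also have "\<dots> \<le> n * p"
      using p n by (simp add: field_simps)
    finally have "sqrt (c * ln 16) \<le> sqrt (n * p)"
      by simp
    then have "32 * c3 \<le> sqrt (n * p)"
      unfolding c3_def by linarith
    then have "32 * c3 * sqrt (n * p) \<le> sqrt (n * p) * sqrt (n * p)"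
      by (rule mult_right_mono) (use p in simp)
    also have "\<dots> = n powr 1 * p"
      using p n by simp
    \<comment> \<open>This is where k \<ge> 2 enters: the exponent k/2 is at least 1.\<close>
    also have "\<dots> \<le> n powr (k / 2) * p"
      using p n assms by (intro mult_right_mono powr_mono) auto
    finally have "c3 * sqrt (n * p) \<le> 1 / 32 * real n powr (real k / 2) * p"
      by simp
    moreover have "c3 * sqrt (n * p) \<le> 1 / 32 * sqrt (n * p)"
      using p by (intro mult_right_mono) (auto simp: c3_def)
    ultimately have le: "c3 * sqrt (n * p) \<le>
        min (1 / 32 * sqrt (real n * p)) (1 / 32 * real n powr (real k / 2) * p)"
      by (rule min.boundedI[rotated])
    have "1 / 3 \<le> minimax_error_prob k n p
        (min (1 / 32 * sqrt (real n * p)) (1 / 32 * real n powr (real k / 2) * p))"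
      using assms n p by (intro minimax_error_prob_ge) simp_all
    also have "\<dots> \<le> minimax_error_prob k n p (c3 * sqrt (real n * p))"
      using p le by (intro minimax_error_prob_antimono) simp_all
    finally show "1 / 3 \<le> minimax_error_prob k n p (c3 * sqrt (real n * p))" .
  qed
qed

end
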